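(* For every integer $k\ge1$, every graph $G$ with $\chi(G)\ge(3+\frac{1}{16})k$ contains a $(k+1)$-connected subgraph with more than $\chi(G)-k$ vertices and chromatic number at least $\chi(G)-2k+2$.
   Context: All graphs are finite, with no loops or parallel edges. $\chi(G)$ denotes the chromatic number of $G$. A cutset in a graph $G$ is a (possibly empty) set $X\subset V(G)$ whose removal results in a disconnected graph. For an integer $k\ge1$, $G$ is $k$-connected if it has more than $k$ vertices and has no cutset of cardinality less than $k$. *)

theory Defs
  imports Complex_Main "Graph_Theory.Graph_Theory"
begin

text \<open>
  A finite simple undirected graph is an instance of the locale \<^locale>\<open>pair_graph\<close>: finite,
  loop-free, with a symmetric set of arcs given as ordered pairs, so that an edge $uv$ is
  represented by the two arcs $(u,v)$ and $(v,u)$.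
\<close>

definition proper_coloring :: "'a pair_pre_digraph \<Rightarrow> nat \<Rightarrow> ('a \<Rightarrow> nat) \<Rightarrow> bool" where
  "proper_coloring G n c \<longleftrightarrow>
     (\<forall>v \<in> pverts G. c v < n) \<and> (\<forall>(u, v) \<in> parcs G. c u \<noteq> c v)"

definition chromatic_number :: "'a pair_pre_digraph \<Rightarrow> nat" where
  "chromatic_number G = (LEAST n. \<exists>c. proper_coloring G n c)"

text \<open>The following fact guarantees that the \<open>LEAST\<close> above is attained.\<close>

lemma (in pair_graph) chromatic_number_coloring:
  "\<exists>c. proper_coloring G (chromatic_number G) c"
proof -
  obtain c where c: "bij_betw c (pverts G) {0..<card (pverts G)}"
    using ex_bij_betw_finite_nat[OF pair_finite_verts] by blast
  have "proper_coloring G (card (pverts G)) c"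
    unfolding proper_coloring_def
  proof (intro conjI ballI)
    show "c v < card (pverts G)" if "v \<in> pverts G" for v
      using bij_betwE[OF c] that by simp
    show "case e of (u, v) \<Rightarrow> c u \<noteq> c v" if "e \<in> parcs G" for e
      using inj_on_eq_iff[OF bij_betw_imp_inj_on[OF c] arc_fst_in_verts[OF that] arc_snd_in_verts[OF that]]
        pair_no_loops[OF that]
      by (simp add: case_prod_beta)
  qed
  then have "\<exists>n c. proper_coloring G n c" by blast
  then show ?thesis unfolding chromatic_number_def by (rule LeastI_ex)
qed

text \<open>
  The proper inclusion only excludes the removal of all vertices: the library constant
  \<^const>\<open>connected\<close> is false for the null graph. This does not affect
  \<open>k_connected\<close>, where only sets with fewer than \<open>k < card (pverts G)\<close>
  elements matter.
\<close>

definition cutset :: "'a pair_pre_digraph \<Rightarrow> 'a set \<Rightarrow> bool" where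
  "cutset G X \<longleftrightarrow>
     X \<subset> pverts G \<and> \<not> connected (with_proj G \<restriction> (pverts G - X))"

definition k_connected :: "nat \<Rightarrow> 'a pair_pre_digraph \<Rightarrow> bool" where
  "k_connected k G \<longleftrightarrow> k < card (pverts G) \<and> \<not> (\<exists>X. cutset G X \<and> card X < k)"

end

theory Submission
  imports Defs
begin

text \<open>
  Let \<open>q = \<chi>(G) - 1\<close> and suppose that no subgraph is as required; then every subgraph with more than
  \<open>\<chi>(G) - k\<close> vertices has a cutset of size at most \<open>k\<close> or is colourable with \<open>q + 2 - 2k\<close> colours.
  We show that \<open>G\<close> is \<open>q\<close>-colourable through a precolouring extension statement: some vertices \<open>Y\<close>
  are precoloured, the other vertices \<open>v\<close> have a set \<open>F v\<close> of at most \<open>k\<close> forbidden colours, and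
  \<open>k|Y| + \<Sum>|F v| < 2k\<^sup>2\<close>. Forbidden colours record precoloured vertices with few uncoloured
  neighbours. After discarding those, a separation of the rest leaves uncoloured
  vertices on both sides, and colouring one side after the other respects the bound on the cost.

  If there is no separation, the remaining graph is colourable with few colours, and its colour classes
  have to be recoloured so as to avoid the forbidden colours. This is a list colouring problem for a
  complete multipartite graph with few forbidden pairs. Each class is split into a main part
  and a minimal number of single vertices, and Hall's theorem assigns distinct colours to all the parts.
\<close>

section \<open>Systems of distinct representatives\<close>

text \<open>Hall's marriage theorem by the Halmos-Vaughan induction. A nonempty tight proper
  subfamily is represented first, and deleting its union keeps Hall's condition for the rest. If
  there is none, every nonempty proper subfamily has a surplus, so one colour can be spent on any
  index.\<close>

lemma hall_representatives:
  fixes A :: "'i \<Rightarrow> 'c set"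
  assumes "finite I" "\<And>i. i \<in> I \<Longrightarrow> finite (A i)"
    and "\<And>J. J \<subseteq> I \<Longrightarrow> card J \<le> card (\<Union>(A ` J))"
  shows "\<exists>R. inj_on R I \<and> (\<forall>i\<in>I. R i \<in> A i)"
  using assms
proof (induction "card I" arbitrary: I A rule: less_induct)
  case less
  note fin = \<open>finite I\<close> and finA = less.prems(2) and hall = less.prems(3)
  have less_card: "card J < card (\<Union>(A ` J))" if "J \<subset> I" "card (\<Union>(A ` J)) \<noteq> card J" for J
    using hall[of J] that by (simp add: psubset_imp_subset)
  consider (empty) "I = {}"
    | (tight) J where "J \<subset> I" "J \<noteq> {}" "card (\<Union>(A ` J)) = card J"
    | (loose) i where "i \<in> I" "\<forall>J. J \<subset> I \<longrightarrow> J \<noteq> {} \<longrightarrow> card (\<Union>(A ` J)) \<noteq> card J"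
    by (metis ex_in_conv)
  then show ?case
  proof cases
    case empty
    then show ?thesis by auto
  next
    case (tight J)
    let ?U = "\<Union>(A ` J)"
    have finJ: "finite J" using tight fin finite_subset by blast
    have finU: "finite ?U" using finJ finA tight by blast
    have "card J < card I" using tight fin by (simp add: psubset_card_mono)
    moreover have "i \<in> J \<Longrightarrow> finite (A i)" for i using finA tight by blast
    moreover have "K \<subseteq> J \<Longrightarrow> card K \<le> card (\<Union>(A ` K))" for K using hall tight by blast
    ultimately have "\<exists>R. inj_on R J \<and> (\<forall>i\<in>J. R i \<in> A i)"
      using less.hyps[of J A] finJ by blast
    then obtain R1 where R1: "inj_on R1 J" "\<And>i. i \<in> J \<Longrightarrow> R1 i \<in> A i" by blast
    have "card (I - J) < card I"
      using tight fin by (intro psubset_card_mono) auto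
    moreover have "card K \<le> card (\<Union>((\<lambda>i. A i - ?U) ` K))" if K: "K \<subseteq> I - J" for K
    proof -
      have finK: "finite K" using K fin finite_subset by blast
      have finUK: "finite (\<Union>((\<lambda>i. A i - ?U) ` K))" using finK finA K by blast
      have "card K + card J = card (K \<union> J)"
        using K finK finJ by (subst card_Un_disjoint) auto
      also have "\<dots> \<le> card (\<Union>(A ` (K \<union> J)))"
        using hall[of "K \<union> J"] K tight by blast
      also have "\<Union>(A ` (K \<union> J)) = (\<Union>((\<lambda>i. A i - ?U) ` K)) \<union> ?U" by blast
      also have "card \<dots> = card (\<Union>((\<lambda>i. A i - ?U) ` K)) + card ?U"
        using finUK finU by (subst card_Un_disjoint) auto
      finally show ?thesis using tight by simp
    qed
    ultimately have "\<exists>R. inj_on R (I - J) \<and> (\<forall>i\<in>I - J. R i \<in> A i - ?U)"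
      using less.hyps[of "I - J" "\<lambda>i. A i - ?U"] fin finA by simp
    then obtain R2 where R2: "inj_on R2 (I - J)" "\<And>i. i \<in> I - J \<Longrightarrow> R2 i \<in> A i - ?U" by blast
    let ?R = "\<lambda>i. if i \<in> J then R1 i else R2 i"
    have "R1 ` J \<subseteq> ?U" using R1(2) by blast
    moreover have "R2 ` (I - J) \<inter> ?U = {}" using R2(2) by fast
    ultimately have "R1 ` J \<inter> R2 ` (I - J) = {}" by blast
    then have "inj_on ?R (J \<union> (I - J))" by (rule inj_on_disjoint_Un[OF R1(1) R2(1)])
    moreover have "J \<union> (I - J) = I" using tight by blast
    ultimately have "inj_on ?R I" by simp
    moreover have "\<forall>i\<in>I. ?R i \<in> A i" using R1 R2 by auto
    ultimately show ?thesis by blast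
  next
    case (loose i)
    have "card {i} \<le> card (A i)" using hall[of "{i}"] loose(1) by simp
    then have "A i \<noteq> {}" by auto
    then obtain a where a: "a \<in> A i" by blast
    have lt: "card (I - {i}) < card I"
      using loose(1) fin by (intro psubset_card_mono) auto
    have hall': "card K \<le> card (\<Union>((\<lambda>j. A j - {a}) ` K))" if K: "K \<subseteq> I - {i}" for K
    proof (cases "K = {}")
      case False
      have "K \<subset> I" using K loose(1) by blast
      then have "card K < card (\<Union>(A ` K))" using less_card loose(2) False by simp
      moreover have "card (\<Union>(A ` K)) - 1 \<le> card (\<Union>(A ` K) - {a})"
        by (simp add: card_Diff_singleton_if del: UN_simps)
      moreover have eq: "(\<Union>j\<in>K. A j - {a}) = \<Union>(A ` K) - {a}" by blast
      ultimately show ?thesis unfolding eq by linarith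
    qed simp
    have "\<exists>R. inj_on R (I - {i}) \<and> (\<forall>j\<in>I - {i}. R j \<in> A j - {a})"
      by (rule less.hyps[OF lt _ _ hall']) (use fin finA in auto)
    then obtain R where R: "inj_on R (I - {i})" "\<And>j. j \<in> I - {i} \<Longrightarrow> R j \<in> A j - {a}" by blast
    have "R j \<noteq> a" if "j \<in> I" "j \<noteq> i" for j using R(2)[of j] that by simp
    then have "a \<notin> R ` (I - {i})" by blast
    then have "inj_on (R(i := a)) (insert i (I - {i}))"
      using R(1) by (subst inj_on_insert) (auto simp: inj_on_def)
    then have "inj_on (R(i := a)) I" using loose(1) by (simp add: insert_absorb)
    moreover have "\<forall>j\<in>I. (R(i := a)) j \<in> A j" using R a by auto
    ultimately show ?thesis by blast
  qed
qed

section \<open>List colouring complete multipartite graphs\<close>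

text \<open>The arithmetic that excludes large Hall violators: \<open>p\<close> classes,
  \<open>N\<close> colours, \<open>x\<close> exceptions, \<open>T\<close> classes in a tight set, a
  violator of size \<open>j\<close>. The first product prices the exceptional and tight classes, the
  second the other classes of the violator.\<close>

lemma large_violator_bound:
  fixes p t x T j L N M m :: int
  assumes "M = max p t" "m = min p t" "N = p + t - 1"
    and "1 \<le> x" "0 \<le> T" "x + T \<le> m - 1" "M + 1 \<le> j" "j \<le> p + x"
    and L: "(x + T) * (N - T) + (j - T - 2 * x) * (N - j + 1) \<le> L"
  shows "p * t \<le> L"
proof -
  define h where "h i = (x + T) * (N - T) + (i - T - 2 * x) * (N - i + 1)" for i
  have pt: "p + t = M + m" "p * t = M * m"
    using assms(1,2) by (auto simp: max_def min_def)
  have N: "N = M + m - 1" using assms(3) pt by simp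
  text \<open>\<open>h\<close> is concave, so it suffices to look at the two ends of the range of \<open>j\<close>.\<close>
  have "h (p + x) = p * t + T * (p - 1 - T) + x * (x - 1)"
    unfolding h_def assms(3) by (simp add: algebra_simps)
  moreover have "0 \<le> T * (p - 1 - T)"
    using assms by (intro mult_nonneg_nonneg) auto
  moreover have "0 \<le> x * (x - 1)"
    using assms by (intro mult_nonneg_nonneg) auto
  ultimately have hi: "p * t \<le> h (p + x)" by linarith
  have "h (M + 1) = M * m + (x - 1) * (M - m + 1) + T * (M - T - x)"
    unfolding h_def N by (simp add: algebra_simps)
  moreover have "0 \<le> (x - 1) * (M - m + 1)"
    using assms by (intro mult_nonneg_nonneg) auto
  moreover have "0 \<le> T * (M - T - x)"
    using assms by (intro mult_nonneg_nonneg) auto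
  ultimately have lo: "p * t \<le> h (M + 1)" using pt by linarith
  \<comment> \<open>The second factors in \<open>d1\<close> and \<open>d2\<close> add up to
    \<open>p + x - (M + 1)\<close>, which is nonnegative, so at least one of them is
    nonnegative.\<close>
  have d1: "h j - h (M + 1) = (j - (M + 1)) * (N + 1 + T + 2 * x - (M + 1) - j)"
    unfolding h_def by (simp add: algebra_simps)
  have d2: "h j - h (p + x) = (p + x - j) * (j + p + x - N - 1 - T - 2 * x)"
    unfolding h_def by (simp add: algebra_simps)
  have "p * t \<le> h j"
  proof (cases "0 \<le> N + 1 + T + 2 * x - (M + 1) - j")
    case True
    then have "0 \<le> h j - h (M + 1)" unfolding d1 using assms by (intro mult_nonneg_nonneg) auto
    then show ?thesis using lo by linarith
  next
    case False
    then have "0 \<le> h j - h (p + x)" unfolding d2 using assms by (intro mult_nonneg_nonneg) auto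
    then show ?thesis using hi by linarith
  qed
  then show ?thesis using L unfolding h_def by linarith
qed

text \<open>The concave parabola \<open>j * (p + t - j)\<close> takes the value \<open>p * t\<close>
  at \<open>j = p\<close> and at \<open>j = t\<close>, hence at least this value in between.\<close>

lemma small_or_large:
  fixes j p t L :: int
  assumes "j * (p + t - j) \<le> L" "L < p * t"
  shows "j < min p t \<or> max p t < j"
proof (rule ccontr)
  assume "\<not> ?thesis"
  then have "0 \<le> (j - min p t) * (max p t - j)" by (intro mult_nonneg_nonneg) auto
  also have "\<dots> = j * (p + t - j) - p * t"
    by (auto simp: min_def max_def algebra_simps)
  finally show False using assms by linarith
qed

text \<open>Double counting of the pairs of a vertex and a colour of \<open>M\<close> forbidden for
  it.\<close>

lemma sum_card_fibres_le:
  fixes F :: "'a \<Rightarrow> 'c set"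
  assumes "finite V" "finite M" "\<And>v. v \<in> V \<Longrightarrow> finite (F v)"
    and "\<And>a. a \<in> M \<Longrightarrow> r \<le> card {v \<in> V. a \<in> F v}"
  shows "r * card M \<le> (\<Sum>v\<in>V. card (F v))"
proof -
  have "r * card M = (\<Sum>a\<in>M. r)" by simp
  also have "\<dots> \<le> (\<Sum>a\<in>M. card {v \<in> V. a \<in> F v})"
    using assms(4) by (rule sum_mono)
  also have "\<dots> = (\<Sum>a\<in>M. \<Sum>v\<in>V. if a \<in> F v then 1 else 0)"
    using assms(1) by (simp add: sum.If_cases Int_def)
  also have "\<dots> = (\<Sum>v\<in>V. \<Sum>a\<in>M. if a \<in> F v then 1 else 0)"
    by (rule sum.swap)
  also have "\<dots> = (\<Sum>v\<in>V. card (M \<inter> F v))"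
    using assms(2) by (simp add: sum.If_cases)
  also have "\<dots> \<le> (\<Sum>v\<in>V. card (F v))"
    using assms(3) by (intro sum_mono card_mono) auto
  finally show ?thesis .
qed

text \<open>For \<open>t \<le> card P\<close> the bound on the sum is sharp: with one vertex per
  class and the same \<open>t\<close> colours forbidden at each of them, only
  \<open>card P - 1\<close> colours remain for \<open>card P\<close> classes.\<close>

lemma multipartite_list_colouring:
  fixes V :: "'a set" and P :: "'i set" and cls :: "'a \<Rightarrow> 'i"
    and F :: "'a \<Rightarrow> 'c set" and Q :: "'c set" and t :: nat
  assumes finV: "finite V" and finP: "finite P" and finQ: "finite Q"
    and cls: "cls ` V \<subseteq> P"
    and FQ: "\<And>v. v \<in> V \<Longrightarrow> F v \<subseteq> Q"
    and Fp: "\<And>v. v \<in> V \<Longrightarrow> card (F v) \<le> card P"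
    and L: "(\<Sum>v\<in>V. card (F v)) < card P * t"
    and N: "card P + t = card Q + 1"
  shows "\<exists>f. (\<forall>v\<in>V. f v \<in> Q - F v) \<and> (\<forall>u\<in>V. \<forall>v\<in>V. cls u \<noteq> cls v \<longrightarrow> f u \<noteq> f v)"
proof -
  define fib where "fib C = {v \<in> V. cls v = C}" for C
  define e where "e C = (\<Sum>v\<in>fib C. card (F v))" for C
  define A where "A n C = {a \<in> Q. card {v \<in> fib C. a \<in> F v} \<le> n}" for n :: nat and C
  define ok where "ok m \<longleftrightarrow> (\<exists>R. inj_on R P \<and> (\<forall>C\<in>P. R C \<in> A (m C) C))" for m :: "'i \<Rightarrow> nat"
  define l where "l = (\<Sum>v\<in>V. card (F v))"
  define Mx Mn where "Mx = max (card P) t" and "Mn = min (card P) t"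
  have t: "1 \<le> t" using L by (cases t) auto
  have finfib: "finite (fib C)" for C unfolding fib_def using finV by simp
  have finF: "v \<in> V \<Longrightarrow> finite (F v)" for v using FQ finQ finite_subset by blast
  have AQ: "A n C \<subseteq> Q" for n C unfolding A_def by blast
  have finA: "finite (A n C)" for n C using AQ finQ finite_subset by blast
  have e_le: "(\<Sum>C\<in>D. e C) \<le> l" if "D \<subseteq> P" for D
  proof -
    have "(\<Sum>C\<in>D. e C) \<le> (\<Sum>C\<in>P. e C)" using that finP by (intro sum_mono2) auto
    also have "\<dots> = l" unfolding e_def l_def fib_def by (rule sum.group[OF finV finP cls])
    finally show ?thesis .
  qed
  \<comment> \<open>A colour outside \<open>A n C\<close> is forbidden for at least
    \<open>n + 1\<close> vertices of \<open>C\<close>, so every colour outside \<open>B\<close> adds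
    that much to the cost of \<open>C\<close>.\<close>
  have pay: "Suc n * card (Q - B) \<le> e C" if "A n C \<subseteq> B" for n C B
    unfolding e_def
  proof (rule sum_card_fibres_le)
    show "Suc n \<le> card {v \<in> fib C. a \<in> F v}" if "a \<in> Q - B" for a
      using that \<open>A n C \<subseteq> B\<close> unfolding A_def by (auto simp: not_le)
  qed (use finfib finQ finF in \<open>auto simp: fib_def\<close>)

  text \<open>Each class \<open>C\<close> reserves a colour \<open>R C\<close> that is forbidden for at most \<open>m C\<close> of its vertices;
    those vertices will receive private colours. We keep the total number of exceptions minimal.\<close>
  have "\<exists>R. inj_on R P \<and> R ` P \<subseteq> Q"
    by (rule card_le_inj[OF finP finQ, simplified conj_commute]) (use N t in linarith)
  then obtain R0 where R0: "inj_on R0 P" "R0 ` P \<subseteq> Q" by blast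
  \<comment> \<open>With \<open>card V\<close> exceptions per class no colour is excluded, so any
    injection of the classes into \<open>Q\<close> is admissible and a minimum exists.\<close>
  have "ok (\<lambda>_. card V)"
    unfolding ok_def
  proof (intro exI[of _ R0] conjI ballI)
    fix C assume "C \<in> P"
    then show "R0 C \<in> A (card V) C"
      using R0 unfolding A_def fib_def by (auto intro: card_mono[OF finV])
  qed (rule R0)
  then obtain m where m: "ok m" and m_min: "\<And>m'. ok m' \<Longrightarrow> sum m P \<le> sum m' P"
    using ex_has_least_nat[of ok _ "\<lambda>m. sum m P"] by blast
  define x where "x = sum m P"
  obtain R where R: "inj_on R P" "\<And>C. C \<in> P \<Longrightarrow> R C \<in> A (m C) C"
    using m unfolding ok_def by blast
  \<comment> \<open>\<open>AT T\<close> holds the colours acceptable to classes of \<open>T\<close>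
    with their current numbers of exceptions. The choice \<open>R\<close> yields Hall's condition
    for it; \<open>T\<close> is tight if \<open>card (AT T) = card T\<close>.\<close>
  define AT where "AT T = (\<Union>D\<in>T. A (m D) D)" for T
  have ATQ: "AT T \<subseteq> Q" for T using AQ unfolding AT_def by blast
  have finAT: "finite (AT T)" for T using ATQ finQ by (rule finite_subset)
  have card_AT: "card T \<le> card (AT T)" if "T \<subseteq> P" for T
  proof (rule card_inj_on_le)
    show "inj_on R T" using R that inj_on_subset by blast
    show "R ` T \<subseteq> AT T" using R that unfolding AT_def by blast
  qed (rule finAT)

  \<comment> \<open>Tight sets that block the exceptional classes\<close>
  define W where "W = {C \<in> P. 1 \<le> m C}"
  have finW: "finite W" unfolding W_def using finP by simp
  have xW: "x = sum m W" unfolding x_def W_def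
    using finP by (intro sum.mono_neutral_right) auto
  have cardW: "card W \<le> x" unfolding xW using sum_mono[of W "\<lambda>_. 1" m] by (simp add: W_def)

  text \<open>By minimality, lowering \<open>m C\<close> creates a Hall violator through \<open>C\<close>. Hence almost all colours
    are forbidden at least \<open>m C\<close> times in \<open>C\<close>, and the classes of the remaining tight set are
    even more expensive.\<close>
  have "\<exists>T. T \<subseteq> P \<and> C \<notin> T \<and> card (AT T) = card T \<and> A (m C - 1) C \<subseteq> AT T" if C: "C \<in> W" for C
  proof -
    define m' where "m' = m(C := m C - 1)"
    have CP: "C \<in> P" and mC: "1 \<le> m C" using C unfolding W_def by auto
    have "sum m' P < sum m P"
      unfolding m'_def using CP mC finP by (intro sum_strict_mono_ex1) auto
    then have "\<not> ok m'" using m_min[of m'] by auto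
    then obtain J where J: "J \<subseteq> P" "card (\<Union>D\<in>J. A (m' D) D) < card J"
      using hall_representatives[OF finP, of "\<lambda>D. A (m' D) D"] AQ finQ
      unfolding ok_def by (meson finite_subset not_le)
    have "C \<in> J"
    proof (rule ccontr)
      assume "C \<notin> J"
      then have "(\<Union>D\<in>J. A (m' D) D) = AT J"
        unfolding m'_def AT_def by (intro SUP_cong) auto
      then show False using J(2) card_AT[OF J(1)] by simp
    qed
    define T where "T = J - {C}"
    have TP: "T \<subseteq> P" using J unfolding T_def by blast
    have finT: "finite J" using J finP finite_subset by blast
    have cardJ: "card J = Suc (card T)"
      using card_Suc_Diff1[OF finT \<open>C \<in> J\<close>] unfolding T_def by simp
    have "AT T = (\<Union>D\<in>T. A (m' D) D)"
      unfolding T_def AT_def m'_def by (intro SUP_cong) auto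
    moreover have "J = insert C T" using \<open>C \<in> J\<close> unfolding T_def by blast
    ultimately have "(\<Union>D\<in>J. A (m' D) D) = A (m C - 1) C \<union> AT T"
      by (simp only: UN_insert m'_def fun_upd_same)
    \<comment> \<open>The union has at most \<open>card T\<close> elements and its subset
      \<open>AT T\<close> at least as many, so both agree: \<open>T\<close> is tight and already
      covers \<open>A (m C - 1) C\<close>.\<close>
    then have le: "card (A (m C - 1) C \<union> AT T) \<le> card T" using J(2) cardJ by (simp only: less_Suc_eq_le)
    have "card (AT T) \<le> card (A (m C - 1) C \<union> AT T)"
      using finAT finA by (intro card_mono) auto
    with le card_AT[OF TP] have "card (AT T) = card T" by simp
    moreover have "AT T = A (m C - 1) C \<union> AT T"
      using le card_AT[OF TP] finAT finA by (intro card_seteq) auto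
    ultimately show ?thesis using TP T_def by blast
  qed
  then obtain TT where TT: "\<And>C. C \<in> W \<Longrightarrow> TT C \<subseteq> P" "\<And>C. C \<in> W \<Longrightarrow> C \<notin> TT C"
      "\<And>C. C \<in> W \<Longrightarrow> card (AT (TT C)) = card (TT C)"
      "\<And>C. C \<in> W \<Longrightarrow> A (m C - 1) C \<subseteq> AT (TT C)"
    by metis
  have cardQ: "card (Q - AT T) = card Q - card (AT T)" for T
    using ATQ finAT by (simp add: card_Diff_subset)
  \<comment> \<open>A colour outside \<open>AT T\<close> is forbidden more than \<open>m D\<close>
    times in every class \<open>D\<close> of \<open>T\<close>. For \<open>C\<close> in
    \<open>W\<close>, whose set \<open>TT C\<close> only covers \<open>A (m C - 1) C\<close>, the
    count in \<open>payW\<close> drops to \<open>m C\<close>.\<close>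
  have payT: "(m D + 1) * (card Q - card (AT T)) \<le> e D" if "D \<in> T" for D T
  proof -
    have "A (m D) D \<subseteq> AT T" using that unfolding AT_def by blast
    from pay[OF this] show ?thesis unfolding cardQ by simp
  qed
  have payW: "m C * (card Q - card (AT T)) \<le> e C" if "C \<in> W" "AT (TT C) \<subseteq> AT T" for C T
  proof -
    have "A (m C - 1) C \<subseteq> AT T" using TT(4)[OF that(1)] that(2) by blast
    moreover have "Suc (m C - 1) = m C" using that(1) unfolding W_def by simp
    ultimately show ?thesis using pay[of "m C - 1" C "AT T"] unfolding cardQ by (simp only:)
  qed

  \<comment> \<open>Each of the \<open>s = card (TT C) + 1\<close> classes in
    \<open>insert C (TT C)\<close> pays at least \<open>card P + t - s\<close>, so
    \<open>small_or_large\<close> applies to \<open>s\<close>; the large alternative contradicts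
    \<open>s \<le> card P\<close>.\<close>
  have TT_small: "card (TT C) + 2 \<le> Mn" if C: "C \<in> W" for C
  proof -
    have CP: "C \<in> P" "1 \<le> m C" using C unfolding W_def by auto
    have finTT: "finite (TT C)" using TT(1)[OF C] finP finite_subset by blast
    define d where "d = card Q - card (TT C)"
    have sub: "insert C (TT C) \<subseteq> P" using TT(1)[OF C] CP by blast
    have ci: "card (insert C (TT C)) = card (TT C) + 1" using TT(2)[OF C] finTT by simp
    have cle: "card (TT C) + 1 \<le> card P" using card_mono[OF finP sub] ci by simp
    have "(card (TT C) + 1) * d = (\<Sum>D\<in>insert C (TT C). d)" using ci by simp
    also have "\<dots> \<le> (\<Sum>D\<in>insert C (TT C). e D)"
    proof (rule sum_mono)
      fix D assume "D \<in> insert C (TT C)"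
      then have "1 * d \<le> e D"
      proof
        assume "D = C"
        have "1 * d \<le> m C * d" using CP by (intro mult_right_mono) auto
        also have "\<dots> \<le> e C" using payW[OF C, of "TT C"] TT(3)[OF C] unfolding d_def by simp
        finally show ?thesis using \<open>D = C\<close> by simp
      next
        assume "D \<in> TT C"
        then show ?thesis using payT[of D "TT C"] TT(3)[OF C] unfolding d_def by simp
      qed
      then show "d \<le> e D" by simp
    qed
    also have "\<dots> \<le> l" by (rule e_le[OF sub])
    finally have "(card (TT C) + 1) * d \<le> l" .
    moreover have "int d = int (card P) + int t - int (card (TT C) + 1)"
      unfolding d_def using N cle t by (simp add: of_nat_diff)
    ultimately have "int (card (TT C) + 1) * (int (card P) + int t - int (card (TT C) + 1)) \<le> int l"
      by (metis of_nat_le_iff of_nat_mult)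
    moreover have "int l < int (card P) * int t" using L unfolding l_def by (metis of_nat_less_iff of_nat_mult)
    ultimately have "int (card (TT C) + 1) < min (int (card P)) (int t) \<or> max (int (card P)) (int t) < int (card (TT C) + 1)"
      by (rule small_or_large)
    then show ?thesis using cle unfolding Mn_def by auto
  qed

  define T where "T = (\<Union>C\<in>W. TT C)"
  have TP: "T \<subseteq> P" using TT(1) unfolding T_def by blast
  have finT: "finite T" using TP finP finite_subset by blast
  \<comment> \<open>\<open>u D\<close> is the price that \<open>payT\<close> and \<open>payW\<close>
    guarantee for each colour outside a tight set; the total price is
    \<open>x + card T\<close>.\<close>
  define u where "u D = m D + (if D \<in> T then 1 else 0)" for D
  have sum_u: "(\<Sum>D\<in>T \<union> W. u D) = x + card T"
  proof -
    have "(\<Sum>D\<in>T \<union> W. m D) = x"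
      unfolding x_def using TP finP W_def by (intro sum.mono_neutral_left) auto
    moreover have "(\<Sum>D\<in>T \<union> W. if D \<in> T then 1 else 0) = card T"
      using finT finW by (simp add: sum.If_cases Int_absorb1)
    ultimately show ?thesis unfolding u_def by (simp add: sum.distrib)
  qed
  have TWP: "T \<union> W \<subseteq> P" using TP W_def by blast
  have pt: "Mn * Mx = card P * t" "Mn + Mx = card P + t" unfolding Mn_def Mx_def by (auto simp: min_def max_def)
  \<comment> \<open>By \<open>TT_small\<close> each \<open>TT C\<close> leaves at least
    \<open>Mx + 1\<close> colours outside, so a total weight of \<open>Mn\<close> would already cost
    \<open>Mn * Mx = card P * t\<close>.\<close>
  have xT: "x + card T < Mn"
  proof (rule ccontr)
    assume "\<not> ?thesis"
    then have "Mn * Mx \<le> (x + card T) * (Mx + 1)" by (intro mult_mono) auto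
    also have "\<dots> = (\<Sum>D\<in>T \<union> W. u D * (Mx + 1))" unfolding sum_u[symmetric] by (rule sum_distrib_right)
    also have "\<dots> \<le> (\<Sum>D\<in>T \<union> W. e D)"
    proof (rule sum_mono)
      fix D assume D: "D \<in> T \<union> W"
      show "u D * (Mx + 1) \<le> e D"
      proof (cases "D \<in> T")
        case True
        then obtain C where C: "C \<in> W" "D \<in> TT C" unfolding T_def by blast
        have "Mx + 1 \<le> card Q - card (AT (TT C))" using TT_small[OF C(1)] TT(3)[OF C(1)] N pt by linarith
        then have "u D * (Mx + 1) \<le> (m D + 1) * (card Q - card (AT (TT C)))"
          unfolding u_def using True by (intro mult_mono) auto
        also have "\<dots> \<le> e D" by (rule payT[OF C(2)])
        finally show ?thesis .
      next
        case False
        then have DW: "D \<in> W" using D by blast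
        have "Mx + 1 \<le> card Q - card (AT (TT D))" using TT_small[OF DW] TT(3)[OF DW] N pt by linarith
        then have "u D * (Mx + 1) \<le> m D * (card Q - card (AT (TT D)))"
          unfolding u_def using False by (intro mult_mono) auto
        also have "\<dots> \<le> e D" by (rule payW[OF DW]) simp
        finally show ?thesis .
      qed
    qed
    also have "\<dots> \<le> l" by (rule e_le[OF TWP])
    finally show False using L pt unfolding l_def by simp
  qed
  \<comment> \<open>Uncrossing: the number of colours in \<open>AT\<close> is submodular and never
    below the number of classes, so tight sets are closed under union.\<close>
  have tight_Un: "card (AT (S1 \<union> S2)) = card (S1 \<union> S2)"
    if S: "S1 \<subseteq> P" "S2 \<subseteq> P" "card (AT S1) = card S1" "card (AT S2) = card S2" for S1 S2
  proof -
    have fin: "finite S1" "finite S2" using S finP finite_subset by blast+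
    have Un: "AT (S1 \<union> S2) = AT S1 \<union> AT S2" unfolding AT_def by blast
    have "card (S1 \<inter> S2) \<le> card (AT (S1 \<inter> S2))" using S by (intro card_AT) auto
    also have "\<dots> \<le> card (AT S1 \<inter> AT S2)"
      using finAT by (intro card_mono) (auto simp: AT_def)
    finally have "card (S1 \<inter> S2) \<le> card (AT S1 \<inter> AT S2)" .
    moreover have "card (AT S1) + card (AT S2) = card (AT (S1 \<union> S2)) + card (AT S1 \<inter> AT S2)"
      unfolding Un by (rule card_Un_Int[OF finAT finAT])
    moreover have "card S1 + card S2 = card (S1 \<union> S2) + card (S1 \<inter> S2)"
      by (rule card_Un_Int[OF fin])
    ultimately have "card (AT (S1 \<union> S2)) \<le> card (S1 \<union> S2)" using S by linarith
    then show ?thesis using card_AT[of "S1 \<union> S2"] S by auto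
  qed
  have "card (AT (\<Union>C\<in>W'. TT C)) = card (\<Union>C\<in>W'. TT C)" if "W' \<subseteq> W" for W'
    using finite_subset[OF that finW] that
  proof (induction W' rule: finite_induct)
    case empty
    then show ?case by (simp add: AT_def)
  next
    case (insert C W')
    have "(\<Union>D\<in>insert C W'. TT D) = TT C \<union> (\<Union>D\<in>W'. TT D)" by blast
    moreover have "(\<Union>D\<in>W'. TT D) \<subseteq> P" using insert.prems TT(1) by blast
    ultimately show ?case using tight_Un[of "TT C" "\<Union>D\<in>W'. TT D"] insert TT by simp
  qed
  then have tightT: "card (AT T) = card T" unfolding T_def by blast
  define d where "d = card Q - card T"
  \<comment> \<open>Since the union \<open>T\<close> is itself tight, all classes of
    \<open>T\<close> and \<open>W\<close> can be charged for the same \<open>d\<close> colours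
    outside \<open>AT T\<close>.\<close>
  have payTW: "(x + card T) * d \<le> (\<Sum>D\<in>T \<union> W. e D)"
  proof -
    have "(x + card T) * d = (\<Sum>D\<in>T \<union> W. u D * d)" unfolding sum_u[symmetric] by (rule sum_distrib_right)
    also have "\<dots> \<le> (\<Sum>D\<in>T \<union> W. e D)"
    proof (rule sum_mono)
      fix D assume D: "D \<in> T \<union> W"
      show "u D * d \<le> e D"
      proof (cases "D \<in> T")
        case True
        then show ?thesis using payT[OF True] unfolding u_def d_def tightT by simp
      next
        case False
        then have DW: "D \<in> W" using D by blast
        then have "AT (TT D) \<subseteq> AT T" unfolding AT_def T_def by blast
        then show ?thesis using payW[OF DW] False unfolding u_def d_def tightT[symmetric] by simp
      qed
    qed
    finally show ?thesis .
  qed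

  \<comment> \<open>Hall's condition for main parts and single vertices\<close>
  define S where "S = {v \<in> V. R (cls v) \<in> F v}"
  have finS: "finite S" using finV unfolding S_def by simp
  have cardS: "card S \<le> x"
  proof -
    have "card S = (\<Sum>v\<in>S. 1)" by simp
    also have "\<dots> = (\<Sum>C\<in>P. \<Sum>v\<in>{v \<in> S. cls v = C}. 1)"
      by (rule sum.group[symmetric]) (use finS finP cls S_def in auto)
    also have "\<dots> \<le> (\<Sum>C\<in>P. m C)"
    proof (rule sum_mono)
      fix C assume "C \<in> P"
      then have "card {v \<in> fib C. R C \<in> F v} \<le> m C" using R(2) unfolding A_def by blast
      moreover have "{v \<in> fib C. R C \<in> F v} = {v \<in> S. cls v = C}" unfolding S_def fib_def by auto
      ultimately show "(\<Sum>v\<in>{v \<in> S. cls v = C}. 1) \<le> m C" by simp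
    qed
    finally show ?thesis unfolding x_def .
  qed
  \<comment> \<open>\<open>Inl C\<close> stands for the main part of \<open>C\<close>,
    \<open>Inr v\<close> for the exceptional vertex \<open>v\<close> alone. \<open>G\<close> gives
    the colours allowed on a whole part, and \<open>w\<close> counts its forbidden pairs, which
    bounds the number of colours lost.\<close>
  define G where "G = case_sum (\<lambda>C. Q - (\<Union>v\<in>{v \<in> V - S. cls v = C}. F v)) (\<lambda>v. Q - F v)"
  define w where "w = case_sum (\<lambda>C. \<Sum>v\<in>{v \<in> V - S. cls v = C}. card (F v)) (\<lambda>v. card (F v))"
  define I where "I = P <+> S"
  have finI: "finite I" unfolding I_def using finP finS by simp
  have GQ: "G g \<subseteq> Q" for g unfolding G_def by (auto split: sum.splits)
  have finG: "finite (G g)" for g using GQ finQ finite_subset by blast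
  have sum_w: "(\<Sum>g\<in>I. w g) = l"
  proof -
    have "(\<Sum>C\<in>P. \<Sum>v\<in>{v \<in> V - S. cls v = C}. card (F v)) = (\<Sum>v\<in>V - S. card (F v))"
      by (rule sum.group) (use finV finP cls in auto)
    then have "(\<Sum>g\<in>I. w g) = (\<Sum>v\<in>V - S. card (F v)) + (\<Sum>v\<in>S. card (F v))"
      unfolding I_def w_def using finP finS by (simp add: sum.Plus)
    also have "\<dots> = l" unfolding l_def
      using finV by (intro sum.subset_diff[symmetric]) (auto simp: S_def)
    finally show ?thesis .
  qed
  have Gw: "card Q \<le> card (G g) + w g" if "g \<in> I" for g
  proof (cases g)
    case (Inl C)
    let ?B = "\<Union>v\<in>{v \<in> V - S. cls v = C}. F v"
    have "card Q \<le> card (G g \<union> ?B)"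
      unfolding G_def Inl using finQ finV finF by (intro card_mono) auto
    also have "\<dots> \<le> card (G g) + card ?B" by (rule card_Un_le)
    also have "card ?B \<le> w g"
      unfolding w_def Inl using finV by (simp add: card_UN_le)
    finally show ?thesis by simp
  next
    case (Inr v)
    then have "v \<in> V" using that unfolding I_def S_def by auto
    then show ?thesis unfolding G_def w_def Inr using FQ[of v] finF by (simp add: card_Diff_subset)
  qed
  text \<open>A Hall violator \<open>J\<close> costs at least \<open>card J * (card P + t - card J)\<close>, so it is small or large.
    A small one contains no exceptional vertex, and \<open>R\<close> represents the rest; a large one
    contains almost all classes, which together with the price of the exceptions is too expensive.\<close>
  have "card J \<le> card (\<Union>(G ` J))" if JI: "J \<subseteq> I" for J
  proof (rule ccontr)
    assume "\<not> ?thesis"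
    then have viol: "card (\<Union>(G ` J)) < card J" by simp
    have finJ: "finite J" using JI finI finite_subset by blast
    define j where "j = int (card J)"
    have wJ: "int (card Q) + 1 - j \<le> int (w g)" if "g \<in> J" for g
    proof -
      have "card (G g) \<le> card (\<Union>(G ` J))"
        using finJ finG that by (intro card_mono) auto
      then show ?thesis using Gw[of g] viol JI that unfolding j_def by auto
    qed
    have "j * (int (card P) + int t - j) = (\<Sum>g\<in>J. int (card Q) + 1 - j)"
      unfolding j_def using N by (simp add: algebra_simps flip: of_nat_add)
    also have "\<dots> \<le> (\<Sum>g\<in>J. int (w g))" by (intro sum_mono wJ)
    also have "\<dots> \<le> (\<Sum>g\<in>I. int (w g))" using JI finI by (intro sum_mono2) auto
    also have "\<dots> = int l" using sum_w by (simp flip: of_nat_sum)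
    finally have a: "j * (int (card P) + int t - j) \<le> int l" .
    have lt: "int l < int (card P) * int t" using L unfolding l_def by (metis of_nat_less_iff of_nat_mult)
    consider "j < min (int (card P)) (int t)" | "max (int (card P)) (int t) < j"
      using small_or_large[OF a lt] by blast
    then show False
    proof cases
      case 1
      have "J \<subseteq> Inl ` P"
      proof
        fix g assume g: "g \<in> J"
        show "g \<in> Inl ` P"
        proof (cases g)
          case (Inl C)
          then show ?thesis using g JI unfolding I_def by auto
        next
          case (Inr v)
          then have "v \<in> V" using g JI unfolding I_def S_def by auto
          \<comment> \<open>A violator with \<open>j < min (card P) t\<close> requires
            \<open>w g \<ge> card P + t - j > card P\<close>, more than a single vertex can
            forbid.\<close>
          then have "w g \<le> card P" unfolding w_def Inr using Fp by simp
          then show ?thesis using wJ[OF g] 1 N by linarith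
        qed
      qed
      then obtain J' where J': "J = Inl ` J'" "J' \<subseteq> P" by (meson subset_image_iff)
      have "card J = card J'" unfolding J' by (simp add: card_image)
      also have "\<dots> \<le> card (\<Union>(G ` J))"
      proof (rule card_inj_on_le)
        show "inj_on R J'" using R J' inj_on_subset by blast
        show "R ` J' \<subseteq> \<Union>(G ` J)"
        proof
          fix a assume "a \<in> R ` J'"
          then obtain C where C: "C \<in> J'" "a = R C" by blast
          have "a \<in> Q" using C R(2) J' AQ by blast
          then have "a \<in> G (Inl C)" unfolding G_def S_def using C by auto
          then show "a \<in> \<Union>(G ` J)" using C J' by blast
        qed
        show "finite (\<Union>(G ` J))" using finJ finG by blast
      qed
      finally show False using viol by simp
    next
      case 2
      \<comment> \<open>The classes of \<open>J\<close> without exceptions and outside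
        \<open>T\<close>. There are at least \<open>j - card T - 2 * x\<close> of them:
        \<open>T\<close> and \<open>W\<close> account for at most \<open>card T + x\<close> members
        of \<open>J\<close>, the single vertices for at most \<open>x\<close>.\<close>
      define E where "E = {C \<in> P. C \<notin> T \<union> W \<and> Inl C \<in> J}"
      have finE: "finite E" unfolding E_def using finP by simp
      have cS: "card (Inr ` S :: ('i + 'a) set) = card S" by (rule card_image) simp
      have cP: "card (Inl ` D :: ('i + 'a) set) = card D" for D by (rule card_image) simp
      have "J \<subseteq> Inl ` E \<union> Inl ` (T \<union> W) \<union> Inr ` S"
      proof
        fix g assume g: "g \<in> J"
        then have "g \<in> P <+> S" using JI unfolding I_def by blast
        then show "g \<in> Inl ` E \<union> Inl ` (T \<union> W) \<union> Inr ` S"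
          using g unfolding E_def by (cases g) auto
      qed
      then have "card J \<le> card (Inl ` E \<union> Inl ` (T \<union> W) \<union> Inr ` S :: ('i + 'a) set)"
        using finE finT finW finS by (intro card_mono) auto
      also have "\<dots> \<le> card (Inl ` E \<union> Inl ` (T \<union> W) :: ('i + 'a) set) + card S"
        using card_Un_le[of "Inl ` E \<union> Inl ` (T \<union> W) :: ('i + 'a) set" "Inr ` S"] unfolding cS .
      also have "card (Inl ` E \<union> Inl ` (T \<union> W) :: ('i + 'a) set) \<le> card E + card (T \<union> W)"
        using card_Un_le[of "Inl ` E :: ('i + 'a) set" "Inl ` (T \<union> W)"] unfolding cP .
      also have "card (T \<union> W) \<le> card T + card W" by (rule card_Un_le)
      finally have cJ: "j \<le> int (card E) + int (card T) + 2 * int x"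
        using cardS cardW unfolding j_def by linarith
      have "card J \<le> card I" using JI finI by (rule card_mono[rotated])
      also have "\<dots> = card P + card S" unfolding I_def using finP finS by (simp add: card_Plus)
      finally have jx: "j \<le> int (card P) + int x" using cardS unfolding j_def by linarith
      have "int (card E) * (int (card Q) + 1 - j) = (\<Sum>C\<in>E. int (card Q) + 1 - j)" by simp
      also have "\<dots> \<le> (\<Sum>C\<in>E. int (e C))"
      proof (rule sum_mono)
        fix C assume "C \<in> E"
        then have "int (card Q) + 1 - j \<le> int (w (Inl C))" using wJ unfolding E_def by blast
        also have "w (Inl C) \<le> e C" unfolding w_def e_def
          using finfib by (auto intro!: sum_mono2 simp: fib_def)
        finally show "int (card Q) + 1 - j \<le> int (e C)" by simp
      qed
      finally have payE: "int (card E) * (int (card Q) + 1 - j) \<le> int (\<Sum>C\<in>E. e C)" by simp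
      have "(\<Sum>D\<in>T \<union> W. e D) + (\<Sum>C\<in>E. e C) = (\<Sum>C\<in>T \<union> W \<union> E. e C)"
        using finT finW finE by (intro sum.union_disjoint[symmetric]) (auto simp: E_def)
      also have "\<dots> \<le> l" using TWP by (intro e_le) (auto simp: E_def)
      finally have "int ((x + card T) * d) + int (card E) * (int (card Q) + 1 - j) \<le> int l"
        using payTW payE by linarith
      moreover have "card T \<le> card Q" using card_mono[OF finQ ATQ[of T]] tightT by simp
      then have "int d = int (card Q) - int (card T)" unfolding d_def by (simp add: of_nat_diff)
      moreover have "(j - int (card T) - 2 * int x) * (int (card Q) - j + 1) \<le> int (card E) * (int (card Q) + 1 - j)"
      proof -
        have "0 \<le> int (card Q) - j + 1" using jx xT N unfolding Mn_def by linarith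
        then have "(j - int (card T) - 2 * int x) * (int (card Q) - j + 1) \<le> int (card E) * (int (card Q) - j + 1)"
          using cJ by (intro mult_right_mono) auto
        then show ?thesis by (simp add: algebra_simps)
      qed
      ultimately have "(int x + int (card T)) * (int (card Q) - int (card T))
          + (j - int (card T) - 2 * int x) * (int (card Q) - j + 1) \<le> int l"
        by (simp add: algebra_simps)
      then have "int (card P) * int t \<le> int l"
        by (rule large_violator_bound[OF refl refl _ _ _ _ _ jx, rotated -1])
          (use N xT jx 2 in \<open>auto simp: Mn_def\<close>)
      then show False using lt by simp
    qed
  qed
  then have "\<exists>r. inj_on r I \<and> (\<forall>g\<in>I. r g \<in> G g)"
    using hall_representatives[OF finI] finG by blast
  then obtain r where r: "inj_on r I" "\<And>g. g \<in> I \<Longrightarrow> r g \<in> G g" by blast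
  define gr where "gr v = (if v \<in> S then Inr v else Inl (cls v))" for v
  have grI: "gr v \<in> I" if "v \<in> V" for v using that cls unfolding gr_def I_def by auto
  show ?thesis
  proof (intro exI[of _ "\<lambda>v. r (gr v)"] conjI ballI impI)
    fix v assume v: "v \<in> V"
    have "G (gr v) \<subseteq> Q - F v" using v unfolding gr_def G_def by auto
    then show "r (gr v) \<in> Q - F v" using r(2)[OF grI[OF v]] by blast
  next
    fix u v assume uv: "u \<in> V" "v \<in> V" "cls u \<noteq> cls v"
    then have "gr u \<noteq> gr v" unfolding gr_def by auto
    then show "r (gr u) \<noteq> r (gr v)" using inj_onD[OF r(1)] grI uv by blast
  qed
qed

text \<open>Surplus colours are absorbed by raising \<open>t\<close> to
  \<open>card Q + 1 - card P\<close>, and only forbidden colours inside \<open>Q\<close>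
  count.\<close>

lemma multipartite_list_colouring_le:
  fixes cls :: "'a \<Rightarrow> 'i" and F :: "'a \<Rightarrow> 'c set"
  assumes "finite V" "finite P" "finite Q" "cls ` V \<subseteq> P"
    and Fp: "\<And>v. v \<in> V \<Longrightarrow> card (F v \<inter> Q) \<le> card P"
    and L: "(\<Sum>v\<in>V. card (F v \<inter> Q)) < card P * t"
    and N: "card P + t \<le> card Q + 1"
  shows "\<exists>f. (\<forall>v\<in>V. f v \<in> Q - F v) \<and> (\<forall>u\<in>V. \<forall>v\<in>V. cls u \<noteq> cls v \<longrightarrow> f u \<noteq> f v)"
proof -
  have "card P * t \<le> card P * (card Q + 1 - card P)"
    using N by (intro mult_left_mono) auto
  then have "(\<Sum>v\<in>V. card (F v \<inter> Q)) < card P * (card Q + 1 - card P)" using L by linarith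
  then have "\<exists>f. (\<forall>v\<in>V. f v \<in> Q - F v \<inter> Q) \<and> (\<forall>u\<in>V. \<forall>v\<in>V. cls u \<noteq> cls v \<longrightarrow> f u \<noteq> f v)"
    by (intro multipartite_list_colouring[OF assms(1-4) _ Fp]) (use N in auto)
  then obtain f where "\<forall>v\<in>V. f v \<in> Q - F v \<inter> Q"
      "\<forall>u\<in>V. \<forall>v\<in>V. cls u \<noteq> cls v \<longrightarrow> f u \<noteq> f v"
    by blast
  then show ?thesis by (intro exI[of _ f]) auto
qed

section \<open>Extending precolourings\<close>

definition colourable_on :: "('a \<Rightarrow> 'a \<Rightarrow> bool) \<Rightarrow> nat \<Rightarrow> 'a set \<Rightarrow> bool" where
  "colourable_on E p U \<longleftrightarrow> (\<exists>h. \<forall>u\<in>U. h u < p \<and> (\<forall>v\<in>U. E u v \<longrightarrow> h u \<noteq> h v))"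

definition separated_on :: "('a \<Rightarrow> 'a \<Rightarrow> bool) \<Rightarrow> nat \<Rightarrow> 'a set \<Rightarrow> bool" where
  "separated_on E k U \<longleftrightarrow> (\<exists>A B X. U = A \<union> B \<union> X \<and> A \<inter> B = {} \<and> A \<inter> X = {} \<and> B \<inter> X = {} \<and>
     A \<noteq> {} \<and> B \<noteq> {} \<and> card X \<le> k \<and> (\<forall>a\<in>A. \<forall>b\<in>B. \<not> E a b))"

text \<open>Only edges meeting \<open>V\<close> are constrained, so \<open>c\<close> may give
  adjacent vertices of \<open>Y\<close> the same colour. This lets a coloured separator become part
  of \<open>Y\<close>.\<close>

definition extends_precolouring ::
  "('a \<Rightarrow> 'a \<Rightarrow> bool) \<Rightarrow> nat \<Rightarrow> 'a set \<Rightarrow> 'a set \<Rightarrow> ('a \<Rightarrow> nat) \<Rightarrow> ('a \<Rightarrow> nat set) \<Rightarrow> ('a \<Rightarrow> nat) \<Rightarrow> bool" where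
  "extends_precolouring E q V Y c F f \<longleftrightarrow> (\<forall>v\<in>V. f v < q \<and> f v \<notin> F v \<and>
     (\<forall>y\<in>Y. E v y \<longrightarrow> f v \<noteq> c y) \<and> (\<forall>u\<in>V. E v u \<longrightarrow> f v \<noteq> f u))"

lemma precolouring_extension_of_colourable:
  assumes k: "1 \<le> k" "k + 1 \<le> p" "q + 2 = p + 2 * k"
    and fin: "finite V" "finite Y"
    and c: "c ` Y \<subseteq> {..<q}"
    and F: "\<And>v. v \<in> V \<Longrightarrow> finite (F v)" "\<And>v. v \<in> V \<Longrightarrow> card (F v) < k"
    and cost: "k * card Y + (\<Sum>v\<in>V. card (F v)) < 2 * k * k"
    and col: "colourable_on E p (V \<union> Y)"
  shows "\<exists>f. extends_precolouring E q V Y c F f"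
proof -
  obtain h where h: "\<And>u. u \<in> V \<union> Y \<Longrightarrow> h u < p"
      "\<And>u v. u \<in> V \<union> Y \<Longrightarrow> v \<in> V \<union> Y \<Longrightarrow> E u v \<Longrightarrow> h u \<noteq> h v"
    using col unfolding colourable_on_def by blast
  define Q where "Q = {..<q} - c ` Y"
  have finQ: "finite Q" unfolding Q_def by simp
  have cardQ: "card Q = q - card (c ` Y)"
    unfolding Q_def using c fin by (simp add: card_Diff_subset)
  have cY: "card (c ` Y) \<le> card Y" using fin by (simp add: card_image_le)
  have w: "card Y < 2 * k"
  proof (rule ccontr)
    assume "\<not> ?thesis"
    then have "2 * k * k \<le> k * card Y" by (subst mult.commute) (intro mult_left_mono, auto)
    then show False using cost by linarith
  qed
  define t where "t = 2 * k - card Y"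
  have L: "(\<Sum>v\<in>V. card (F v)) < k * t"
    unfolding t_def using cost w by (simp add: right_diff_distrib' algebra_simps)
  have FQ: "card (F v \<inter> Q) \<le> card (F v)" if "v \<in> V" for v
    using F(1)[OF that] by (intro card_mono) auto
  have sumFQ: "(\<Sum>v\<in>V'. card (F v \<inter> Q)) \<le> (\<Sum>v\<in>V. card (F v))" if "V' \<subseteq> V" for V'
  proof -
    have "(\<Sum>v\<in>V'. card (F v \<inter> Q)) \<le> (\<Sum>v\<in>V'. card (F v))" using FQ that by (intro sum_mono) auto
    also have "\<dots> \<le> (\<Sum>v\<in>V. card (F v))" using fin that by (intro sum_mono2) auto
    finally show ?thesis .
  qed
  have free: ?thesis
    if "p + s \<le> card Q + 1" "(\<Sum>v\<in>V. card (F v \<inter> Q)) < p * s" for s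
  proof -
    have "\<exists>f. (\<forall>v\<in>V. f v \<in> Q - F v) \<and> (\<forall>u\<in>V. \<forall>v\<in>V. h u \<noteq> h v \<longrightarrow> f u \<noteq> f v)"
    proof (rule multipartite_list_colouring_le[of V "{..<p}" Q h F s])
      show "card (F v \<inter> Q) \<le> card {..<p}" if "v \<in> V" for v
        using FQ[OF that] F(2)[OF that] k by simp
    qed (use fin finQ h that in auto)
    then obtain f where f: "\<And>v. v \<in> V \<Longrightarrow> f v \<in> Q - F v"
        "\<And>u v. u \<in> V \<Longrightarrow> v \<in> V \<Longrightarrow> h u \<noteq> h v \<Longrightarrow> f u \<noteq> f v"
      by blast
    have "extends_precolouring E q V Y c F f"
      unfolding extends_precolouring_def
    proof (intro ballI conjI impI)
      fix v assume v: "v \<in> V"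
      show "f v < q" "f v \<notin> F v" using f(1)[OF v] unfolding Q_def by auto
      show "f v \<noteq> c y" if "y \<in> Y" for y using f(1)[OF v] that unfolding Q_def by auto
      show "f v \<noteq> f u" if "u \<in> V" "E v u" for u using f(2)[of v u] h(2)[of v u] that v by blast
    qed
    then show ?thesis by blast
  qed
  text \<open>In the fresh case the class of \<open>y\<close> is coloured like \<open>y\<close> itself. In the blocked case one colour
    is missing, but every colour used on \<open>Y\<close> is also forbidden somewhere, which lowers the
    number of relevant forbidden pairs by \<open>card Y\<close>.\<close>
  consider (merged) "\<not> inj_on c Y"
    | (fresh) y where "inj_on c Y" "y \<in> Y" "\<forall>v\<in>V. h v = h y \<longrightarrow> c y \<notin> F v"
    | (blocked) "inj_on c Y" "\<forall>y\<in>Y. \<exists>v\<in>V. h v = h y \<and> c y \<in> F v"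
    by blast
  then show ?thesis
  proof cases
    case merged
    \<comment> \<open>A repeated colour on \<open>Y\<close> frees exactly the colour that is
      missing.\<close>
    have "card (c ` Y) \<noteq> card Y" using merged fin eq_card_imp_inj_on by blast
    then have "card (c ` Y) < card Y" using cY by simp
    then have "p + t \<le> card Q + 1" using k w unfolding cardQ t_def by linarith
    moreover have "k * t \<le> p * t" using k by (intro mult_right_mono) auto
    then have "(\<Sum>v\<in>V. card (F v \<inter> Q)) < p * t" using sumFQ[OF subset_refl] L by linarith
    ultimately show ?thesis by (rule free)
  next
    case (fresh y)
    define V' where "V' = {v \<in> V. h v \<noteq> h y}"
    define P where "P = {..<p} - {h y}"
    have cardP: "card P = p - 1" unfolding P_def using h(1)[of y] fresh(2) by simp
    have cardQ': "card Q = q - card Y" using cardQ fresh(1) by (simp add: card_image)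
    have "k * t \<le> (p - 1) * t" using k by (intro mult_right_mono) auto
    moreover have "(\<Sum>v\<in>V'. card (F v \<inter> Q)) \<le> (\<Sum>v\<in>V. card (F v))"
      by (rule sumFQ) (auto simp: V'_def)
    ultimately have sum': "(\<Sum>v\<in>V'. card (F v \<inter> Q)) < card P * t" using L unfolding cardP by linarith
    have "\<exists>f. (\<forall>v\<in>V'. f v \<in> Q - F v) \<and> (\<forall>u\<in>V'. \<forall>v\<in>V'. h u \<noteq> h v \<longrightarrow> f u \<noteq> f v)"
    proof (rule multipartite_list_colouring_le[of V' P Q h F t, OF _ _ finQ _ _ sum'])
      show "card (F v \<inter> Q) \<le> card P" if "v \<in> V'" for v
        using FQ[of v] F(2)[of v] k that unfolding cardP V'_def by auto
      show "card P + t \<le> card Q + 1" unfolding cardP cardQ' t_def using k w by linarith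
    qed (use fin h(1) in \<open>auto simp: V'_def P_def\<close>)
    then obtain f where f: "\<And>v. v \<in> V' \<Longrightarrow> f v \<in> Q - F v"
        "\<And>u v. u \<in> V' \<Longrightarrow> v \<in> V' \<Longrightarrow> h u \<noteq> h v \<Longrightarrow> f u \<noteq> f v"
      by blast
    define g where "g v = (if h v = h y then c y else f v)" for v
    have fQ: "f v < q" "f v \<notin> F v" "\<And>y. y \<in> Y \<Longrightarrow> f v \<noteq> c y" if "v \<in> V" "h v \<noteq> h y" for v
      using f(1)[of v] that unfolding V'_def Q_def by auto
    have "extends_precolouring E q V Y c F g"
      unfolding extends_precolouring_def
    proof (intro ballI conjI impI)
      fix v assume v: "v \<in> V"
      show "g v < q" using fQ[OF v] c fresh(2) unfolding g_def by auto
      show "g v \<notin> F v" using fQ[OF v] fresh(3) v unfolding g_def by auto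
      show "g v \<noteq> c z" if "z \<in> Y" "E v z" for z
      proof (cases "h v = h y")
        case True
        then have "z \<noteq> y" using h(2)[of v z] that v by auto
        then show ?thesis using True fresh(1,2) that unfolding g_def by (auto dest: inj_onD)
      next
        case False
        then show ?thesis using fQ[OF v] that unfolding g_def by auto
      qed
      show "g v \<noteq> g u" if "u \<in> V" "E v u" for u
      proof -
        have "h v \<noteq> h u" using h(2)[of v u] that v by blast
        then show ?thesis
          using fQ(3)[OF v _ fresh(2)] fQ(3)[OF that(1) _ fresh(2)] f(2)[of v u] v that
          unfolding g_def V'_def by auto
      qed
    qed
    then show ?thesis by blast
  next
    case blocked
    have cardQ': "card Q = q - card Y" using cardQ blocked(1) by (simp add: card_image)
    have "1 * card (c ` Y) \<le> (\<Sum>v\<in>V. card (F v \<inter> c ` Y))"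
    proof (rule sum_card_fibres_le)
      fix a assume "a \<in> c ` Y"
      then have "{v \<in> V. a \<in> F v \<inter> c ` Y} \<noteq> {}" using blocked(2) by blast
      then show "1 \<le> card {v \<in> V. a \<in> F v \<inter> c ` Y}" using fin by (simp add: Suc_le_eq card_gt_0_iff)
    qed (use fin in auto)
    then have "card Y \<le> (\<Sum>v\<in>V. card (F v \<inter> c ` Y))" using blocked(1) by (simp add: card_image)
    moreover have "(\<Sum>v\<in>V. card (F v \<inter> Q)) + (\<Sum>v\<in>V. card (F v \<inter> c ` Y)) \<le> (\<Sum>v\<in>V. card (F v))"
      unfolding sum.distrib[symmetric]
    proof (rule sum_mono)
      fix v assume v: "v \<in> V"
      have "card (F v \<inter> Q) + card (F v \<inter> c ` Y) = card (F v \<inter> Q \<union> F v \<inter> c ` Y)"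
        using F(1)[OF v] by (intro card_Un_disjoint[symmetric]) (auto simp: Q_def)
      also have "\<dots> \<le> card (F v)" using F(1)[OF v] by (intro card_mono) auto
      finally show "card (F v \<inter> Q) + card (F v \<inter> c ` Y) \<le> card (F v)" .
    qed
    ultimately have sumQ: "(\<Sum>v\<in>V. card (F v \<inter> Q)) + card Y < k * t" using L by linarith
    have t1: "t = Suc (t - 1)" using w unfolding t_def by simp
    then have kt: "k * t = k * (t - 1) + k" by (metis mult_Suc_right add.commute)
    \<comment> \<open>With \<open>t - 1\<close> in place of \<open>t\<close> the budget becomes
      \<open>p * (t - 1)\<close>. It suffices because \<open>k + 1 \<le> p\<close> adds
      \<open>t - 1\<close> to \<open>k * (t - 1)\<close>, while the saving of \<open>card Y\<close>
      pairs leaves at most \<open>k - card Y \<le> t - 1\<close> to be covered.\<close>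
    have "k * (t - 1) + (t - 1) \<le> p * (t - 1)"
      using mult_right_mono[OF k(2), of "t - 1"] by simp
    moreover have "card Y < k \<Longrightarrow> k - card Y \<le> t - 1" using k unfolding t_def by linarith
    ultimately have "(\<Sum>v\<in>V. card (F v \<inter> Q)) < p * (t - 1)"
      using sumQ kt by linarith
    moreover have "p + (t - 1) \<le> card Q + 1" unfolding cardQ' t_def using k w by linarith
    ultimately show ?thesis using free by blast
  qed
qed

text \<open>The induction measure counts uncoloured vertices twice and precoloured ones once, so
  both colouring a vertex and discarding a precoloured one make progress. When no local reduction
  applies, the degrees make the graph large enough for \<open>dichotomy\<close>.\<close>

lemma precolouring_extension:
  assumes sym: "\<And>u v. E u v \<Longrightarrow> E v u" and irrefl: "\<And>v. \<not> E v v"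
    and k: "1 \<le> k" "k + 1 \<le> p" "q + 2 = p + 2 * k"
    and fin: "finite V0"
    and dichotomy: "\<And>U. U \<subseteq> V0 \<Longrightarrow> q + 1 < card U + k \<Longrightarrow> colourable_on E p U \<or> separated_on E k U"
    and "V \<union> Y \<subseteq> V0" "V \<inter> Y = {}" "c ` Y \<subseteq> {..<q}"
    and "\<And>v. v \<in> V \<Longrightarrow> finite (F v)" "\<And>v. v \<in> V \<Longrightarrow> card (F v) \<le> k"
    and "k * card Y + (\<Sum>v\<in>V. card (F v)) < 2 * k * k"
  shows "\<exists>f. extends_precolouring E q V Y c F f"
  using assms(8-13)
proof (induction "card V + card (V \<union> Y)" arbitrary: V Y c F rule: less_induct)
  case less
  note VY = less.prems(1) and disj = less.prems(2) and c = less.prems(3)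
    and finF = less.prems(4) and cardF = less.prems(5) and cost = less.prems(6)
  have finV: "finite V" and finY: "finite Y" using VY fin finite_subset by blast+
  have cost_V: "(\<Sum>v\<in>V'. card (F v)) \<le> (\<Sum>v\<in>V. card (F v))" if "V' \<subseteq> V" for V'
    using that finV by (intro sum_mono2) auto
  consider (empty) "V = {}"
    | (full) v where "v \<in> V" "card (F v) = k"
    | (poor) y where "y \<in> Y" "card {v \<in> V. E v y} \<le> k" "\<forall>v\<in>V. card (F v) < k"
    | (low) v where "v \<in> V" "card (F v) + card {u \<in> V \<union> Y. E v u} < q"
    | (rich) "V \<noteq> {}" "\<forall>v\<in>V. card (F v) < k" "\<forall>y\<in>Y. k < card {v \<in> V. E v y}"
        "\<forall>v\<in>V. q \<le> card (F v) + card {u \<in> V \<union> Y. E v u}"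
  proof -
    have "v \<in> V \<Longrightarrow> card (F v) \<noteq> k \<Longrightarrow> card (F v) < k" for v using cardF[of v] by simp
    then show thesis using that by (meson not_le)
  qed
  then show ?case
  proof cases
    case empty
    then show ?thesis unfolding extends_precolouring_def by simp
  next
    case (full v)
    text \<open>Colouring \<open>v\<close> at once trades \<open>k\<close> forbidden pairs for one precoloured vertex.\<close>
    have split: "(\<Sum>u\<in>V. card (F u)) = k + (\<Sum>u\<in>V - {v}. card (F u))"
      using full finV by (simp add: sum.remove)
    have w: "card Y + 1 < 2 * k"
    proof (rule ccontr)
      assume "\<not> ?thesis"
      then have "2 * k * k \<le> k * (card Y + 1)" by (subst mult.commute) (intro mult_left_mono, auto)
      then have "2 * k * k \<le> k * card Y + k" by simp
      then show False using cost split by linarith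
    qed
    \<comment> \<open>At most \<open>k + card Y \<le> 3 * k - 2\<close> colours are blocked, while
      \<open>k + 1 \<le> p\<close> gives \<open>q \<ge> 3 * k - 1\<close>.\<close>
    have "card (F v \<union> c ` Y) \<le> k + card Y"
      using card_Un_le[of "F v" "c ` Y"] card_image_le[OF finY, of c] full(2) by linarith
    also have "\<dots> < card {..<q}" using w k by simp
    finally have "\<not> {..<q} \<subseteq> F v \<union> c ` Y"
      using finF[OF full(1)] finY by (meson card_mono finite_UnI finite_imageI not_le)
    then obtain a where a: "a < q" "a \<notin> F v" "a \<notin> c ` Y" by blast
    have vY: "v \<notin> Y" using full disj by blast
    have "\<exists>f. extends_precolouring E q (V - {v}) (insert v Y) (c(v := a)) F f"
    proof (rule less.hyps)
      have "card (V - {v}) < card V" using full finV by (intro psubset_card_mono) auto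
      moreover have "V - {v} \<union> insert v Y = V \<union> Y" using full by blast
      ultimately show "card (V - {v}) + card (V - {v} \<union> insert v Y) < card V + card (V \<union> Y)" by simp
      show "k * card (insert v Y) + (\<Sum>u\<in>V - {v}. card (F u)) < 2 * k * k"
        using cost split vY finY by simp
    qed (use full VY disj c a finF cardF in auto)
    then obtain f where f: "extends_precolouring E q (V - {v}) (insert v Y) (c(v := a)) F f" by blast
    have fu: "f u < q" "f u \<notin> F u" "E u v \<Longrightarrow> f u \<noteq> a" "\<And>y. y \<in> Y \<Longrightarrow> E u y \<Longrightarrow> f u \<noteq> c y"
        "\<And>u'. u' \<in> V - {v} \<Longrightarrow> E u u' \<Longrightarrow> f u \<noteq> f u'" if "u \<in> V" "u \<noteq> v" for u
    proof -
      have *: "f u < q \<and> f u \<notin> F u \<and> (\<forall>y\<in>insert v Y. E u y \<longrightarrow> f u \<noteq> (c(v := a)) y)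
          \<and> (\<forall>u'\<in>V - {v}. E u u' \<longrightarrow> f u \<noteq> f u')"
        using f that unfolding extends_precolouring_def by blast
      show "f u < q" "f u \<notin> F u" using * by blast+
      show "E u v \<Longrightarrow> f u \<noteq> a" using * by auto
      show "f u \<noteq> c y" if "y \<in> Y" "E u y" for y using * that vY by (cases "y = v") auto
      show "f u \<noteq> f u'" if "u' \<in> V - {v}" "E u u'" for u' using * that by blast
    qed
    have "extends_precolouring E q V Y c F (f(v := a))"
      unfolding extends_precolouring_def
    proof (intro ballI conjI impI)
      fix u assume u: "u \<in> V"
      show "(f(v := a)) u < q" "(f(v := a)) u \<notin> F u"
        using fu(1,2)[OF u] a by auto
      show "(f(v := a)) u \<noteq> c y" if "y \<in> Y" "E u y" for y
        using fu(4)[OF u _ that] a(3) that by auto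
      show "(f(v := a)) u \<noteq> (f(v := a)) u'" if u': "u' \<in> V" "E u u'" for u'
      proof (cases "u = v")
        case True
        then have "u' \<noteq> v" using u' irrefl by blast
        then show ?thesis using fu(3)[OF u'(1)] sym[OF u'(2)] True by auto
      next
        case False
        then show ?thesis using fu(3)[OF u] fu(5)[OF u, of u'] u' by (cases "u' = v") auto
      qed
    qed
    then show ?thesis by blast
  next
    case (poor y)
    text \<open>Conversely, \<open>y\<close> is traded for at most \<open>k\<close> forbidden pairs.\<close>
    define F' where "F' v = (if E v y then insert (c y) (F v) else F v)" for v
    have "(\<Sum>v\<in>V. card (F' v)) \<le> (\<Sum>v\<in>V. card (F v) + (if E v y then 1 else 0))"
      unfolding F'_def using finF by (intro sum_mono) (auto simp: card_insert_if)
    also have "\<dots> = (\<Sum>v\<in>V. card (F v)) + card {v \<in> V. E v y}"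
      using finV by (simp add: sum.distrib sum.If_cases Int_def)
    finally have sumF': "(\<Sum>v\<in>V. card (F' v)) \<le> (\<Sum>v\<in>V. card (F v)) + k" using poor(2) by linarith
    have cardY: "card Y = Suc (card (Y - {y}))" using card_Suc_Diff1[OF finY poor(1)] by simp
    have "\<exists>f. extends_precolouring E q V (Y - {y}) c F' f"
    proof (rule less.hyps)
      have "card (V \<union> (Y - {y})) < card (V \<union> Y)"
        using poor(1) disj finV finY by (intro psubset_card_mono) auto
      then show "card V + card (V \<union> (Y - {y})) < card V + card (V \<union> Y)" by simp
      show "k * card (Y - {y}) + (\<Sum>v\<in>V. card (F' v)) < 2 * k * k"
        using cost sumF' unfolding cardY by simp
      show "finite (F' v)" "card (F' v) \<le> k" if "v \<in> V" for v
        using finF[OF that] poor(3) that unfolding F'_def by (auto simp: card_insert_if Suc_le_eq)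
    qed (use VY disj c in auto)
    then obtain f where f: "extends_precolouring E q V (Y - {y}) c F' f" by blast
    have "extends_precolouring E q V Y c F f"
      unfolding extends_precolouring_def
    proof (intro ballI conjI impI)
      fix v assume v: "v \<in> V"
      have fv: "f v < q" "f v \<notin> F' v" "\<And>z. z \<in> Y - {y} \<Longrightarrow> E v z \<Longrightarrow> f v \<noteq> c z"
          "\<And>u. u \<in> V \<Longrightarrow> E v u \<Longrightarrow> f v \<noteq> f u"
        using f v unfolding extends_precolouring_def by blast+
      show "f v < q" "f v \<notin> F v" using fv(1,2) unfolding F'_def by (auto split: if_splits)
      show "f v \<noteq> c z" if "z \<in> Y" "E v z" for z
        using fv(2) fv(3)[of z] that unfolding F'_def by (cases "z = y") auto
      show "f v \<noteq> f u" if "u \<in> V" "E v u" for u using fv(4) that .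
    qed
    then show ?thesis by blast
  next
    case (low v)
    \<comment> \<open>Greedy step: \<open>v\<close> is coloured last, since its forbidden colours
      and its neighbours together block fewer than \<open>q\<close> colours.\<close>
    have "\<exists>f. extends_precolouring E q (V - {v}) Y c F f"
    proof (rule less.hyps)
      have "card (V - {v}) < card V" using low(1) finV by (intro psubset_card_mono) auto
      moreover have "card (V - {v} \<union> Y) \<le> card (V \<union> Y)" using finV finY by (intro card_mono) auto
      ultimately show "card (V - {v}) + card (V - {v} \<union> Y) < card V + card (V \<union> Y)" by linarith
      show "k * card Y + (\<Sum>u\<in>V - {v}. card (F u)) < 2 * k * k"
        using cost cost_V[of "V - {v}"] by auto
    qed (use VY disj c finF cardF in auto)
    then obtain f where f: "extends_precolouring E q (V - {v}) Y c F f" by blast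
    define B where "B = F v \<union> (\<lambda>u. if u \<in> V then f u else c u) ` {u \<in> V \<union> Y. E v u}"
    have finB: "finite B" unfolding B_def using finF[OF low(1)] finV finY by simp
    have "card B \<le> card (F v) + card ((\<lambda>u. if u \<in> V then f u else c u) ` {u \<in> V \<union> Y. E v u})"
      unfolding B_def by (rule card_Un_le)
    also have "\<dots> \<le> card (F v) + card {u \<in> V \<union> Y. E v u}"
      using finV finY by (intro add_left_mono card_image_le) auto
    also have "\<dots> < card {..<q}" using low(2) by simp
    finally have "\<not> {..<q} \<subseteq> B" using card_mono[OF finB] by (meson not_le)
    then obtain a where a: "a < q" "a \<notin> B" by blast
    have aV: "a \<noteq> f u" if "u \<in> V" "E v u" for u using a(2) that unfolding B_def by auto
    have aY: "a \<noteq> c u" if "u \<in> Y" "E v u" for u using a(2) that disj unfolding B_def by (auto simp: image_iff)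
    have "extends_precolouring E q V Y c F (f(v := a))"
      unfolding extends_precolouring_def
    proof (intro ballI conjI impI)
      fix u assume u: "u \<in> V"
      have fu: "f u < q" "f u \<notin> F u" "\<And>z. z \<in> Y \<Longrightarrow> E u z \<Longrightarrow> f u \<noteq> c z"
          "\<And>u'. u' \<in> V - {v} \<Longrightarrow> E u u' \<Longrightarrow> f u \<noteq> f u'" if "u \<noteq> v"
        using f u that unfolding extends_precolouring_def by blast+
      show "(f(v := a)) u < q" "(f(v := a)) u \<notin> F u"
        using fu(1,2) a unfolding B_def by auto
      show "(f(v := a)) u \<noteq> c y" if "y \<in> Y" "E u y" for y
        using fu(3) aY that by auto
      show "(f(v := a)) u \<noteq> (f(v := a)) u'" if u': "u' \<in> V" "E u u'" for u'
      proof (cases "u = v")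
        case True
        then have "u' \<noteq> v" using u' irrefl by blast
        then show ?thesis using aV u' True by simp
      next
        case False
        then show ?thesis
          using fu(4)[OF False, of u'] aV[OF u] u' sym[OF u'(2)] by (cases "u' = v") auto
      qed
    qed
    then show ?thesis by blast
  next
    case rich
    obtain v where v: "v \<in> V" using rich(1) by blast
    \<comment> \<open>The degree of \<open>v\<close> exceeds \<open>q - k\<close>, so the graph has
      more than \<open>q + 1 - k\<close> vertices, the size that \<open>dichotomy\<close> asks
      for.\<close>
    have "card (insert v {u \<in> V \<union> Y. E v u}) \<le> card (V \<union> Y)"
      using v finV finY by (intro card_mono) auto
    then have "card {u \<in> V \<union> Y. E v u} + 1 \<le> card (V \<union> Y)"
      using irrefl finV finY by simp
    moreover have "q \<le> card (F v) + card {u \<in> V \<union> Y. E v u}" "card (F v) < k"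
      using rich v by auto
    ultimately have "q + 1 < card (V \<union> Y) + k" by linarith
    then consider "colourable_on E p (V \<union> Y)" | "separated_on E k (V \<union> Y)"
      using dichotomy[OF VY] by blast
    then show ?thesis
    proof cases
      case 1
      show ?thesis
        by (rule precolouring_extension_of_colourable[OF k finV finY c finF _ cost 1])
          (use rich in auto)
    next
      case 2
      text \<open>The cheaper side of the separation can be coloured last: there the separator joins the
        precoloured vertices and costs at most \<open>k * k\<close>, half of the budget.\<close>
      define load where "load S = k * card (Y \<inter> S) + (\<Sum>v\<in>V \<inter> S. card (F v))" for S
      \<comment> \<open>If a side had only precoloured vertices, the uncoloured neighbours of any of
        them would lie in \<open>X\<close>; these are at most \<open>k\<close>, too few in the
        present case.\<close>
      have meets: "V \<inter> A \<noteq> {}" if m: "V \<union> Y = A \<union> B \<union> X" "A \<noteq> {}" "card X \<le> k"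
          "\<forall>a\<in>A. \<forall>b\<in>B. \<not> E a b" for A B X
      proof
        assume VA: "V \<inter> A = {}"
        obtain y where y: "y \<in> A" using m(2) by blast
        then have "y \<in> Y" using VA m(1) by blast
        have "{v \<in> V. E v y} \<subseteq> X"
        proof
          fix u assume u: "u \<in> {v \<in> V. E v y}"
          then have "u \<in> A \<union> B \<union> X" "u \<notin> A" using m(1) VA by blast+
          moreover have "u \<notin> B" using u m(4) y sym by blast
          ultimately show "u \<in> X" by blast
        qed
        moreover have "finite X" using m(1) finV finY by (metis finite_Un)
        ultimately have "card {v \<in> V. E v y} \<le> card X" by (rule card_mono[rotated])
        moreover have "k < card {v \<in> V. E v y}" using rich(3) \<open>y \<in> Y\<close> by (rule bspec)
        ultimately show False using m(3) by linarith
      qed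
      have glue: ?thesis
        if U: "V \<union> Y = A \<union> B \<union> X" and dj: "A \<inter> B = {}" "A \<inter> X = {}" "B \<inter> X = {}"
          and ne: "V \<inter> A \<noteq> {}" "V \<inter> B \<noteq> {}" and X: "card X \<le> k"
          and AB: "\<forall>a\<in>A. \<forall>b\<in>B. \<not> E a b" and loadB: "load B < k * k" for A B X
      proof -
        have "\<exists>f. extends_precolouring E q (V - B) Y c F f"
        proof (rule less.hyps)
          have "card (V - B) < card V" using ne(2) finV by (intro psubset_card_mono) auto
          moreover have "card (V - B \<union> Y) \<le> card (V \<union> Y)" using finV finY by (intro card_mono) auto
          ultimately show "card (V - B) + card (V - B \<union> Y) < card V + card (V \<union> Y)" by linarith
          show "k * card Y + (\<Sum>u\<in>V - B. card (F u)) < 2 * k * k"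
            using cost cost_V[of "V - B"] by auto
        qed (use VY disj c finF cardF in auto)
        then obtain f where f: "extends_precolouring E q (V - B) Y c F f" by blast
        \<comment> \<open>The vertices of the separator that were uncoloured now count as
          precoloured by \<open>f\<close>.\<close>
        define c' where "c' u = (if u \<in> V then f u else c u)" for u
        have "\<exists>g. extends_precolouring E q (V \<inter> B) (X \<union> Y \<inter> B) c' F g"
        proof (rule less.hyps)
          have "card (V \<inter> B) \<le> card V" using finV by (intro card_mono) auto
          \<comment> \<open>Even if \<open>V \<inter> B = V - X\<close> were large, dropping the
            nonempty side \<open>A\<close> lowers the measure.\<close>
          moreover have "V \<inter> B \<union> (X \<union> Y \<inter> B) \<subset> V \<union> Y"
            using U dj ne(1) by blast
          then have "card (V \<inter> B \<union> (X \<union> Y \<inter> B)) < card (V \<union> Y)"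
            using finV finY by (intro psubset_card_mono) simp_all
          ultimately show "card (V \<inter> B) + card (V \<inter> B \<union> (X \<union> Y \<inter> B)) < card V + card (V \<union> Y)" by linarith
          have "k * card (X \<union> Y \<inter> B) \<le> k * (card X + card (Y \<inter> B))"
            by (intro mult_left_mono card_Un_le) auto
          also have "\<dots> \<le> k * k + k * card (Y \<inter> B)"
            using X by (simp add: distrib_left)
          finally show "k * card (X \<union> Y \<inter> B) + (\<Sum>v\<in>V \<inter> B. card (F v)) < 2 * k * k"
            using loadB unfolding load_def by linarith
          show "V \<inter> B \<union> (X \<union> Y \<inter> B) \<subseteq> V0" using U VY by blast
          show "V \<inter> B \<inter> (X \<union> Y \<inter> B) = {}" using disj dj by blast
          show "c' ` (X \<union> Y \<inter> B) \<subseteq> {..<q}"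
          proof
            fix z assume "z \<in> c' ` (X \<union> Y \<inter> B)"
            then obtain u where u: "u \<in> X \<union> Y \<inter> B" "z = c' u" by blast
            show "z \<in> {..<q}"
            proof (cases "u \<in> V")
              case True
              then have "u \<in> V - B" using u(1) dj disj by blast
              then show ?thesis using f True unfolding u(2) c'_def extends_precolouring_def by auto
            next
              case False
              then have "u \<in> Y" using u(1) U by blast
              then show ?thesis using c False unfolding u(2) c'_def by auto
            qed
          qed
        qed (use finF cardF in auto)
        then obtain g where g: "extends_precolouring E q (V \<inter> B) (X \<union> Y \<inter> B) c' F g" by blast
        have f': "f v < q" "f v \<notin> F v" "\<And>y. y \<in> Y \<Longrightarrow> E v y \<Longrightarrow> f v \<noteq> c y"
            "\<And>u. u \<in> V - B \<Longrightarrow> E v u \<Longrightarrow> f v \<noteq> f u" if "v \<in> V - B" for v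
          using f that unfolding extends_precolouring_def by blast+
        have g': "g v < q" "g v \<notin> F v" "\<And>y. y \<in> X \<union> Y \<inter> B \<Longrightarrow> E v y \<Longrightarrow> g v \<noteq> c' y"
            "\<And>u. u \<in> V \<inter> B \<Longrightarrow> E v u \<Longrightarrow> g v \<noteq> g u" if "v \<in> V \<inter> B" for v
          using g that unfolding extends_precolouring_def by blast+
        have nbr: "u \<in> X \<union> B" if "v \<in> B" "u \<in> V \<union> Y" "E v u" for u v
          using that U AB sym by blast
        have cross: "g v \<noteq> f u" if "v \<in> V \<inter> B" "u \<in> V - B" "E v u" for u v
          using g'(3)[OF that(1), of u] nbr[of v u] that unfolding c'_def by auto
        define r where "r v = (if v \<in> B then g v else f v)" for v
        have "extends_precolouring E q V Y c F r"
          unfolding extends_precolouring_def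
        proof (intro ballI conjI impI)
          fix v assume v: "v \<in> V"
          show "r v < q" "r v \<notin> F v" using f'(1,2)[of v] g'(1,2)[of v] v unfolding r_def by auto
          show "r v \<noteq> c y" if y: "y \<in> Y" "E v y" for y
          proof (cases "v \<in> B")
            case True
            have "y \<notin> V" using y(1) disj by blast
            then show ?thesis
              using g'(3)[of v y] nbr[of v y] True v y unfolding r_def c'_def by auto
          next
            case False
            then show ?thesis using f'(3)[of v y] v y unfolding r_def by auto
          qed
          show "r v \<noteq> r u" if u: "u \<in> V" "E v u" for u
            using f'(4)[of v u] g'(4)[of v u] cross[of v u] cross[of u v] v u sym[OF u(2)]
            unfolding r_def by auto
        qed
        then show ?thesis by blast
      qed
      obtain A B X where sep: "V \<union> Y = A \<union> B \<union> X" "A \<inter> B = {}" "A \<inter> X = {}" "B \<inter> X = {}"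
          "A \<noteq> {}" "B \<noteq> {}" "card X \<le> k" "\<forall>a\<in>A. \<forall>b\<in>B. \<not> E a b"
        using 2 unfolding separated_on_def by blast
      have sep': "V \<union> Y = B \<union> A \<union> X" "B \<inter> A = {}" "\<forall>b\<in>B. \<forall>a\<in>A. \<not> E b a"
        using sep sym by blast+
      have "load A + load B = k * card (Y \<inter> A \<union> Y \<inter> B) + (\<Sum>v\<in>V \<inter> A \<union> V \<inter> B. card (F v))"
        unfolding load_def using sep(2) finV finY
        by (subst card_Un_disjoint, auto)[1] (subst sum.union_disjoint, auto simp: algebra_simps)
      also have "\<dots> \<le> k * card Y + (\<Sum>v\<in>V. card (F v))"
        using finV finY by (intro add_mono mult_left_mono card_mono sum_mono2) auto
      finally have "load A < k * k \<or> load B < k * k" using cost by linarith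
      then show ?thesis
        using glue[OF sep(1-4) meets[OF sep(1,5,7,8)] meets[OF sep'(1) sep(6,7) sep'(3)] sep(7,8)]
          glue[OF sep'(1,2) sep(4,3) meets[OF sep'(1) sep(6,7) sep'(3)] meets[OF sep(1,5,7,8)] sep(7) sep'(3)]
        by blast
    qed
  qed
qed

section \<open>Highly connected subgraphs\<close>

text \<open>The induced subgraph as a pair digraph, so that \<open>chromatic_number\<close> and
  \<open>k_connected\<close> apply to it.\<close>

definition induced_on :: "'a pair_pre_digraph \<Rightarrow> 'a set \<Rightarrow> 'a pair_pre_digraph" where
  "induced_on G U = \<lparr>pverts = U, parcs = parcs G \<inter> U \<times> U\<rparr>"

lemma induced_on_simps [simp]:
  "pverts (induced_on G U) = U" "parcs (induced_on G U) = parcs G \<inter> U \<times> U"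
  by (simp_all add: induced_on_def)

lemma (in pair_graph) pair_graph_induced_on:
  assumes "U \<subseteq> pverts G"
  shows "pair_graph (induced_on G U)"
proof unfold_locales
  show "finite (pverts (induced_on G U))" using finite_subset[OF assms pair_finite_verts] by simp
  show "finite (parcs (induced_on G U))" using pair_finite_arcs by simp
  show "symmetric (with_proj (induced_on G U))"
    using pair_sym_arcs by (auto simp: symmetric_def sym_def)
  show "fst e \<noteq> snd e" if "e \<in> parcs (induced_on G U)" for e
    using that pair_no_loops by simp
qed auto

lemma (in pair_graph) subgraph_induced_on:
  assumes "U \<subseteq> pverts G"
  shows "subgraph (with_proj (induced_on G U)) (with_proj G)"
proof -
  interpret H: pair_graph "induced_on G U" by (rule pair_graph_induced_on[OF assms])
  show ?thesis
    using assms by (auto simp: subgraph_def compatible_def wf_digraph_wp_iff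
        intro: H.pair_wf_digraph_axioms pair_wf_digraph_axioms)
qed

lemma (in pair_graph) chromatic_number_le_iff:
  "chromatic_number G \<le> n \<longleftrightarrow> colourable_on (\<lambda>u v. (u, v) \<in> parcs G) n (pverts G)"
proof
  assume n: "chromatic_number G \<le> n"
  obtain c where "proper_coloring G (chromatic_number G) c" using chromatic_number_coloring by blast
  then have "\<forall>u\<in>pverts G. c u < n \<and> (\<forall>v\<in>pverts G. (u, v) \<in> parcs G \<longrightarrow> c u \<noteq> c v)"
    using n unfolding proper_coloring_def by fastforce
  then show "colourable_on (\<lambda>u v. (u, v) \<in> parcs G) n (pverts G)" unfolding colourable_on_def by blast
next
  assume "colourable_on (\<lambda>u v. (u, v) \<in> parcs G) n (pverts G)"
  then obtain c where "\<forall>u\<in>pverts G. c u < n \<and> (\<forall>v\<in>pverts G. (u, v) \<in> parcs G \<longrightarrow> c u \<noteq> c v)"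
    unfolding colourable_on_def by blast
  then have "proper_coloring G n c"
    unfolding proper_coloring_def by (auto dest: in_arcsD1 in_arcsD2)
  then show "chromatic_number G \<le> n" unfolding chromatic_number_def by (intro Least_le) blast
qed

text \<open>One side is the component, after removal of \<open>X\<close>, of a vertex
  \<open>u\<close> from which some remaining \<open>v\<close> is unreachable; the other side is
  everything else outside \<open>X\<close>.\<close>

lemma (in pair_graph) separated_of_cutset:
  assumes "cutset G X" "card X \<le> k"
  shows "separated_on (\<lambda>u v. (u, v) \<in> parcs G) k (pverts G)"
proof -
  define W where "W = pverts G - X"
  define r where "r = {e \<in> parcs G. fst e \<in> W \<and> snd e \<in> W}"
  have XG: "X \<subset> pverts G" and disc: "\<not> connected (with_proj G \<restriction> W)"
    using assms(1) unfolding cutset_def W_def by auto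
  have "arcs_ends (with_proj G \<restriction> W) = r"
    by (auto simp: arcs_ends_conv r_def)
  moreover have "W \<noteq> {}" using XG unfolding W_def by blast
  ultimately obtain u v where uv: "u \<in> W" "v \<in> W" "(u, v) \<notin> rtrancl_on W (symcl r)"
    using disc unfolding connected_conv by auto
  define A where "A = {w \<in> W. (u, w) \<in> rtrancl_on W (symcl r)}"
  have no_edge: "(a, b) \<notin> parcs G" if ab: "a \<in> A" "b \<in> W - A" for a b
  proof
    assume "(a, b) \<in> parcs G"
    then have "(a, b) \<in> symcl r" using ab unfolding A_def r_def symcl_def by auto
    then have "(u, b) \<in> rtrancl_on W (symcl r)"
      using ab unfolding A_def by (auto intro: rtrancl_on_into_rtrancl_on)
    then show False using ab unfolding A_def by blast
  qed
  have "u \<in> A" "v \<in> W - A" using uv unfolding A_def by auto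
  then have ne: "A \<noteq> {}" "W - A \<noteq> {}" by blast+
  have parts: "pverts G = A \<union> (W - A) \<union> X" "A \<inter> (W - A) = {}" "A \<inter> X = {}" "(W - A) \<inter> X = {}"
    using XG unfolding W_def A_def by blast+
  have "\<forall>a\<in>A. \<forall>b\<in>W - A. (a, b) \<notin> parcs G" using no_edge by (intro ballI)
  with ne parts assms(2) show ?thesis
    unfolding separated_on_def by (intro exI conjI)
qed

text \<open>The inequalities are arranged without subtraction of natural numbers. The bound
  \<open>3 * k\<close> amounts to \<open>k + 1 \<le> p\<close> for the \<open>p\<close> chosen in
  the proof.\<close>

theorem highly_connected_subgraph:
  fixes G :: "'a pair_pre_digraph"
  assumes k: "k \<ge> 1" and G: "pair_graph G" and chi: "3 * k \<le> chromatic_number G"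
  shows "\<exists>H :: 'a pair_pre_digraph.
           pair_graph H \<and> subgraph (with_proj H) (with_proj G) \<and> k_connected (k + 1) H \<and>
           chromatic_number G < card (pverts H) + k \<and>
           chromatic_number G + 2 \<le> chromatic_number H + 2 * k"
proof (rule ccontr)
  assume none: "\<not> ?thesis"
  interpret pair_graph G by (rule G)
  define E where "E u v \<longleftrightarrow> (u, v) \<in> parcs G" for u v
  \<comment> \<open>The contradiction will be a colouring with \<open>q\<close> colours, one fewer
    than the chromatic number. The value \<open>p\<close> is the largest chromatic number that
    misses the last requirement on \<open>H\<close>.\<close>
  define q where "q = chromatic_number G - 1"
  define p where "p = chromatic_number G + 1 - 2 * k"
  have q: "chromatic_number G = q + 1" unfolding q_def using chi k by linarith
  have p: "k + 1 \<le> p" "q + 2 = p + 2 * k" unfolding p_def using chi q by linarith+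
  have sym: "E u v \<Longrightarrow> E v u" for u v
    using pair_sym_arcs unfolding E_def symmetric_def by (auto dest: symD)
  have irrefl: "\<not> E v v" for v using pair_no_loops unfolding E_def by fastforce
  have dichotomy: "colourable_on E p U \<or> separated_on E k U"
    if U: "U \<subseteq> pverts G" "q + 1 < card U + k" for U
  proof -
    let ?H = "induced_on G U"
    interpret H: pair_graph ?H by (rule pair_graph_induced_on[OF U(1)])
    show ?thesis
    proof (cases "k_connected (k + 1) ?H")
      case True
      then have "\<not> chromatic_number G + 2 \<le> chromatic_number ?H + 2 * k"
        using none U q H.pair_graph_axioms subgraph_induced_on[OF U(1)] by auto
      then have "chromatic_number ?H \<le> p" using q p by linarith
      then show ?thesis unfolding H.chromatic_number_le_iff
        unfolding colourable_on_def E_def by auto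
    next
      case False
      \<comment> \<open>\<open>U\<close> has more than \<open>2 * k\<close> vertices, so the failure
        of connectivity must come from a cutset and not from the vertex count.\<close>
      have "k + 1 < card U" using U(2) q chi k by linarith
      then obtain X where X: "cutset ?H X" "card X \<le> k"
        using False unfolding k_connected_def by auto
      have "separated_on (\<lambda>u v. (u, v) \<in> parcs ?H) k U" using H.separated_of_cutset[OF X] by simp
      then obtain A B X where sep: "U = A \<union> B \<union> X" "A \<inter> B = {}" "A \<inter> X = {}" "B \<inter> X = {}"
          "A \<noteq> {}" "B \<noteq> {}" "card X \<le> k" "\<forall>a\<in>A. \<forall>b\<in>B. (a, b) \<notin> parcs ?H"
        unfolding separated_on_def by blast
      then have "\<forall>a\<in>A. \<forall>b\<in>B. \<not> E a b" unfolding E_def by auto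
      then show ?thesis using sep unfolding separated_on_def by blast
    qed
  qed
  \<comment> \<open>Nothing is precoloured or forbidden at the start, so the cost is 0 and the
    colour function on the empty set is a dummy.\<close>
  have "\<exists>f. extends_precolouring E q (pverts G) {} (\<lambda>_. 0) (\<lambda>_. {}) f"
    by (rule precolouring_extension[OF sym irrefl k p pair_finite_verts dichotomy]) (use k in auto)
  then have "colourable_on E q (pverts G)"
    unfolding extends_precolouring_def colourable_on_def by blast
  then show False using chromatic_number_le_iff[of q] q unfolding E_def by simp
qed

theorem theorem1p2:
  fixes k :: nat and G :: "'a pair_pre_digraph"
  assumes "k \<ge> 1"
    and "pair_graph G"
    and "real (chromatic_number G) \<ge> (3 + 1/16) * real k"
  shows "\<exists>H :: 'a pair_pre_digraph.
           pair_graph H \<and> subgraph (with_proj H) (with_proj G) \<and>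
           k_connected (k + 1) H \<and>
           int (card (pverts H)) > int (chromatic_number G) - int k \<and>
           int (chromatic_number H) \<ge> int (chromatic_number G) - 2 * int k + 2"
proof -
  have "real (3 * k) \<le> real (chromatic_number G)" using assms(3) by simp
  then have "3 * k \<le> chromatic_number G" by (simp only: of_nat_le_iff)
  then obtain H :: "'a pair_pre_digraph" where "pair_graph H" "subgraph (with_proj H) (with_proj G)"
      "k_connected (k + 1) H" "chromatic_number G < card (pverts H) + k"
      "chromatic_number G + 2 \<le> chromatic_number H + 2 * k"
    using highly_connected_subgraph[OF assms(1,2)] by blast
  then show ?thesis by (intro exI[of _ H]) auto
qed

end
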